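(* Let $k\geq 3$ be an integer and let $G$ be a 2-connected planar 3-regular graph. Let $F$ be the graph obtained from $G$ by replacing each edge $e=uv\in E(G)$ by the gadget $G_e$ described below. Then \[\gamma_{[kR]}(F)=i_{[kR]}(F)=\tau(G)+k|V(G)|+(3k+2)|E(G)|.\]
   Context: All graphs are finite and simple. The gadget $G_e$ for an edge $e=uv$ (with an arbitrary choice of which endpoint is $u$) consists of ten new vertices $x_1^e,\ldots,x_{10}^e$ and the edges $ux_1^e, x_1^ex_2^e, x_2^ex_3^e, x_3^ex_4^e, x_4^ex_5^e, x_5^ev$, $x_6^ex_7^e, x_7^ex_8^e, x_8^ex_9^e, x_9^ex_{10}^e$, $x_2^ex_7^e$ and $x_4^ex_9^e$; replacing $e$ by $G_e$ means deleting the edge $uv$ and adding these vertices and edges (so $V(F)=V(G)\cup\bigcup_e\{x_1^e,\ldots,x_{10}^e\}$). $\tau(G)$ denotes the minimum size of a vertex cover of $G$ (a set of vertices meeting every edge). For $f\colon V(F)\to\mathbb{Z}_{\ge 0}$ and $S\subseteq V(F)$, $f(S)=\sum_{v\in S}f(v)$, and $AN(v)=\{w\in N(v): f(w)\ge 1\}$. A $[k]$-Roman dominating function ($[k]$-RDF) of a graph $H$ is a function $f\colon V(H)\to\{0,1,\ldots,k+1\}$ such that $f(N[v])\ge k+|AN(v)|$ for every vertex $v$ with $f(v)<k$; its weight is $f(V(H))$. $\gamma_{[kR]}(H)$ is the minimum weight of a $[k]$-RDF of $H$. An independent $[k]$-RDF is a $[k]$-RDF whose set of vertices with positive labels is independent,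 and $i_{[kR]}(H)$ is the minimum weight of an independent $[k]$-RDF of $H$. *)

theory Defs
  imports "HOL-Analysis.Analysis"
begin

section \<open>Finite simple graphs\<close>

text \<open>Edges are two-element sets of vertices; \<open>simple_graph\<close> below imposes this.\<close>

record 'a ugraph =
  verts :: "'a set"
  edges :: "'a set set"

definition simple_graph :: "'a ugraph \<Rightarrow> bool" where
  "simple_graph G \<longleftrightarrow>
     finite (verts G) \<and> (\<forall>e\<in>edges G. e \<subseteq> verts G \<and> card e = 2)"

definition neighborhood :: "'a ugraph \<Rightarrow> 'a \<Rightarrow> 'a set" where
  "neighborhood G v = {w \<in> verts G. {v, w} \<in> edges G}"

definition closed_neighborhood :: "'a ugraph \<Rightarrow> 'a \<Rightarrow> 'a set" where
  "closed_neighborhood G v = insert v (neighborhood G v)"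

definition regular :: "nat \<Rightarrow> 'a ugraph \<Rightarrow> bool" where
  "regular d G \<longleftrightarrow> (\<forall>v\<in>verts G. card (neighborhood G v) = d)"

definition independent_set :: "'a ugraph \<Rightarrow> 'a set \<Rightarrow> bool" where
  "independent_set G S \<longleftrightarrow> S \<subseteq> verts G \<and> (\<forall>u\<in>S. \<forall>v\<in>S. {u, v} \<notin> edges G)"

definition delete_verts :: "'a ugraph \<Rightarrow> 'a set \<Rightarrow> 'a ugraph" where
  "delete_verts G X =
     \<lparr>verts = verts G - X, edges = {e \<in> edges G. e \<inter> X = {}}\<rparr>"

definition connected_graph :: "'a ugraph \<Rightarrow> bool" where
  "connected_graph G \<longleftrightarrow> verts G \<noteq> {} \<and>
     (\<forall>u\<in>verts G. \<forall>v\<in>verts G. (u, v) \<in> {(x, y). {x, y} \<in> edges G}\<^sup>*)"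

text \<open>A graph is \<open>n\<close>-connected if it has more than \<open>n\<close> vertices and no set of
  fewer than \<open>n\<close> vertices disconnects it (so the complete graph on two vertices is not
  2-connected).\<close>

definition vertex_connected :: "nat \<Rightarrow> 'a ugraph \<Rightarrow> bool" where
  "vertex_connected n G \<longleftrightarrow> card (verts G) > n \<and>
     (\<forall>X. X \<subseteq> verts G \<and> card X < n \<longrightarrow> connected_graph (delete_verts G X))"

text \<open>A plane drawing sends vertices to distinct points and edges to simple arcs between
  their end points. The arcs avoid all other vertices, and distinct arcs meet only in
  common end points.\<close>

definition plane_drawing ::
    "'a ugraph \<Rightarrow> ('a \<Rightarrow> real ^ 2) \<Rightarrow> ('a set \<Rightarrow> real \<Rightarrow> real ^ 2) \<Rightarrow> bool" where
  "plane_drawing G p \<gamma> \<longleftrightarrow>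
     inj_on p (verts G) \<and>
     (\<forall>e\<in>edges G. arc (\<gamma> e) \<and> {pathstart (\<gamma> e), pathfinish (\<gamma> e)} = p ` e \<and>
        path_image (\<gamma> e) \<inter> p ` verts G = p ` e) \<and>
     (\<forall>e\<in>edges G. \<forall>e'\<in>edges G. e \<noteq> e' \<longrightarrow>
        path_image (\<gamma> e) \<inter> path_image (\<gamma> e') = p ` (e \<inter> e'))"

definition planar :: "'a ugraph \<Rightarrow> bool" where
  "planar G \<longleftrightarrow> (\<exists>p \<gamma>. plane_drawing G p \<gamma>)"

definition vertex_cover :: "'a ugraph \<Rightarrow> 'a set \<Rightarrow> bool" where
  "vertex_cover G C \<longleftrightarrow> C \<subseteq> verts G \<and> (\<forall>e\<in>edges G. e \<inter> C \<noteq> {})"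

definition cover_number :: "'a ugraph \<Rightarrow> nat" where
  "cover_number G = (LEAST n. \<exists>C. vertex_cover G C \<and> card C = n)"

section \<open>$[k]$-Roman domination\<close>

text \<open>A labelling is a function on the whole type; only its values on the vertex set
  matter below.\<close>

definition active_neighborhood :: "'a ugraph \<Rightarrow> ('a \<Rightarrow> nat) \<Rightarrow> 'a \<Rightarrow> 'a set" where
  "active_neighborhood H f v = {w \<in> neighborhood H v. f w \<ge> 1}"

definition k_RDF :: "nat \<Rightarrow> 'a ugraph \<Rightarrow> ('a \<Rightarrow> nat) \<Rightarrow> bool" where
  "k_RDF k H f \<longleftrightarrow>
     (\<forall>v\<in>verts H. f v \<le> k + 1) \<and>
     (\<forall>v\<in>verts H. f v < k \<longrightarrow>
        sum f (closed_neighborhood H v) \<ge> k + card (active_neighborhood H f v))"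

definition independent_k_RDF :: "nat \<Rightarrow> 'a ugraph \<Rightarrow> ('a \<Rightarrow> nat) \<Rightarrow> bool" where
  "independent_k_RDF k H f \<longleftrightarrow>
     k_RDF k H f \<and> independent_set H {v \<in> verts H. f v \<ge> 1}"

definition k_roman_domination_number :: "nat \<Rightarrow> 'a ugraph \<Rightarrow> nat" where
  "k_roman_domination_number k H = (LEAST w. \<exists>f. k_RDF k H f \<and> sum f (verts H) = w)"

definition independent_k_roman_domination_number :: "nat \<Rightarrow> 'a ugraph \<Rightarrow> nat" where
  "independent_k_roman_domination_number k H =
     (LEAST w. \<exists>f. independent_k_RDF k H f \<and> sum f (verts H) = w)"

section \<open>Replacing edges by gadgets\<close>

text \<open>The choice of which endpoint of \<open>e\<close> plays the role of \<open>u\<close> and which that of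
  \<open>v\<close>.\<close>

definition edge_orientation :: "'a ugraph \<Rightarrow> ('a set \<Rightarrow> 'a) \<Rightarrow> ('a set \<Rightarrow> 'a) \<Rightarrow> bool" where
  "edge_orientation G src tgt \<longleftrightarrow> (\<forall>e\<in>edges G. e = {src e, tgt e})"

text \<open>\<open>Old v\<close> is the vertex \<open>v\<close> of the original graph and \<open>New e i\<close> is $x_i^e$.\<close>

datatype 'a gvertex = Old 'a | New "'a set" nat

definition gadget_edges :: "'a set \<Rightarrow> 'a \<Rightarrow> 'a \<Rightarrow> 'a gvertex set set" where
  "gadget_edges e u v =
     {{Old u, New e 1}, {New e 1, New e 2}, {New e 2, New e 3}, {New e 3, New e 4},
      {New e 4, New e 5}, {New e 5, Old v},
      {New e 6, New e 7}, {New e 7, New e 8}, {New e 8, New e 9}, {New e 9, New e 10},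
      {New e 2, New e 7}, {New e 4, New e 9}}"

definition gadget_graph ::
    "'a ugraph \<Rightarrow> ('a set \<Rightarrow> 'a) \<Rightarrow> ('a set \<Rightarrow> 'a) \<Rightarrow> 'a gvertex ugraph" where
  "gadget_graph G src tgt =
     \<lparr>verts = Old ` verts G \<union> (\<Union>e\<in>edges G. New e ` {1..10}),
      edges = (\<Union>e\<in>edges G. gadget_edges e (src e) (tgt e))\<rparr>"

end

theory Submission
  imports Defs
begin

text \<open>
  Since \<open>f(N(v)) - |AN(v)|\<close> is the sum of \<open>f w - 1\<close> (truncated at \<open>0\<close>) over the neighbours
  \<open>w\<close> of \<open>v\<close>, a \<open>[k]\<close>-RDF is a labelling with \<open>f v + (\<Sum>w\<in>N(v). f w - 1) \<ge> k\<close> at every vertex.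

  For the upper bound, give the vertices of a minimum cover the label \<open>k + 1\<close> and the other old
  vertices the label \<open>k\<close>; a gadget one of whose ends has label \<open>k + 1\<close> can be completed
  independently with weight \<open>3 k + 2\<close>.

  For the lower bound, the conditions at \<open>x\<^sub>6\<close>, \<open>x\<^sub>1\<^sub>0\<close> and \<open>x\<^sub>3\<close> already give weight \<open>3 k\<close>, and a
  gadget weighs at least \<open>3 k + 2\<close> plus \<open>(x\<^sub>1 - 1) + (x\<^sub>5 - 1)\<close>, plus one more if neither end has
  label \<open>k + 1\<close>. Moving \<open>x\<^sub>1 - 1\<close> and \<open>x\<^sub>5 - 1\<close> to the adjacent ends brings every old vertex up
  to at least \<open>k\<close>. The old vertices of label \<open>k + 1\<close> and one end of each gadget with the additional
  unit then form a vertex cover all of whose members have received at least \<open>k + 1\<close>.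
\<close>

section \<open>Labels decreased by one, and the weight of a single gadget\<close>

lemma sum_eq_sum_pred_plus_card_active:
  fixes f :: "'a \<Rightarrow> nat"
  assumes "finite N"
  shows "sum f N = (\<Sum>w\<in>N. f w - 1) + card {w \<in> N. f w \<ge> 1}"
proof -
  have "card {w \<in> N. f w \<ge> 1} = (\<Sum>w\<in>N. if f w \<ge> 1 then 1 else 0)"
    using assms by (simp add: sum.If_cases Int_def)
  also have "(\<Sum>w\<in>N. f w - 1) + \<dots> = (\<Sum>w\<in>N. (f w - 1) + (if f w \<ge> 1 then 1 else 0))"
    by (rule sum.distrib [symmetric])
  also have "\<dots> = sum f N"
    by (rule sum.cong) auto
  finally show ?thesis by simp
qed

text \<open>The guard \<open>f v < k\<close> disappears because the inequality is trivial once
  \<open>f v\<close> is at least \<open>k\<close>; without loops, \<open>f v\<close> splits off from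
  the closed neighbourhood sum.\<close>

lemma k_RDF_iff_sum_pred:
  assumes "finite (verts H)" and loopless: "\<And>v. {v} \<notin> edges H"
  shows "k_RDF k H f \<longleftrightarrow>
    (\<forall>v\<in>verts H. f v \<le> k + 1 \<and> k \<le> f v + (\<Sum>w\<in>neighborhood H v. f w - 1))"
proof -
  have "sum f (closed_neighborhood H v) =
      f v + (\<Sum>w\<in>neighborhood H v. f w - 1) + card (active_neighborhood H f v)" for v
  proof -
    have "finite (neighborhood H v)" "v \<notin> neighborhood H v"
      using assms by (auto simp: neighborhood_def)
    then show ?thesis
      using sum_eq_sum_pred_plus_card_active [of "neighborhood H v" f]
      by (simp add: closed_neighborhood_def active_neighborhood_def)
  qed
  then show ?thesis
    by (auto simp: k_RDF_def not_less)
qed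

lemma gadget_weight_ge:
  fixes k u v x1 x2 x3 x4 x5 x6 x7 x8 x9 x10 :: nat
  assumes "k \<ge> 3" and "u \<le> k + 1" and "v \<le> k + 1"
    and c1: "k \<le> x1 + (u - 1) + (x2 - 1)"
    and c2: "k \<le> x2 + (x1 - 1) + (x3 - 1) + (x7 - 1)"
    and c3: "k \<le> x3 + (x2 - 1) + (x4 - 1)"
    and c4: "k \<le> x4 + (x3 - 1) + (x5 - 1) + (x9 - 1)"
    and c5: "k \<le> x5 + (v - 1) + (x4 - 1)"
    and c6: "k \<le> x6 + (x7 - 1)"
    and c8: "k \<le> x8 + (x7 - 1) + (x9 - 1)"
    and c10: "k \<le> x10 + (x9 - 1)"
  shows "3 * k + 2 + (x1 - 1) + (x5 - 1) + (if u \<le> k \<and> v \<le> k then 1 else 0)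
    \<le> x1 + x2 + x3 + x4 + x5 + x6 + x7 + x8 + x9 + x10"
proof -
  \<comment> \<open>\<open>p\<close> records the unit that truncated subtraction loses. Beyond
    \<open>3 * k + (x1 - 1) + (x5 - 1)\<close> the weight contains
    \<open>p x1 + p x2 + p x4 + p x5\<close> and \<open>x8 + p x7 + p x9\<close>, which have to
    supply the remaining units.\<close>
  define p where "p x = (if x = 0 then 0 else 1::nat)" for x :: nat
  have p: "x = (x - 1) + p x" for x
    by (simp add: p_def)
  have "x7 + x6 \<ge> k + p x7" "x9 + x10 \<ge> k + p x9" "x2 + x3 + x4 \<ge> k + p x2 + p x4"
    using c6 c10 c3 p [of x2] p [of x4] p [of x7] p [of x9] by linarith+
  \<comment> \<open>An end of label at most \<open>k\<close> contributes at most
    \<open>k - 1\<close>, so \<open>x1\<close> and \<open>x2\<close> cannot both vanish.\<close>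
  moreover have "p x1 + p x2 \<ge> 1" if "u \<le> k"
    using c1 that \<open>k \<ge> 3\<close> by (auto simp: p_def)
  moreover have "p x4 + p x5 \<ge> 1" if "v \<le> k"
    using c5 that \<open>k \<ge> 3\<close> by (auto simp: p_def)
  moreover have "x8 + p x7 + p x9 \<ge> 1"
    using c8 \<open>k \<ge> 3\<close> by (auto simp: p_def)
  \<comment> \<open>Now \<open>x1\<close>, \<open>x2\<close>, \<open>x4\<close>, \<open>x5\<close>
    are zero. By \<open>c8\<close>, exactly one of \<open>x7\<close> and \<open>x9\<close> is
    positive. If \<open>x7 = 0\<close>, then \<open>c2\<close> forces \<open>x3\<close> to be at
    least \<open>k + 1\<close>; if \<open>x9 = 0\<close>, then \<open>c4\<close> does.\<close>
  moreover have "x2 + x3 + x4 \<ge> k + p x2 + p x4 + 1"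
    if "p x1 + p x2 + p x4 + p x5 = 0" "x8 + p x7 + p x9 \<le> 1"
    using c2 c4 c8 that \<open>k \<ge> 3\<close> by (auto simp: p_def split: if_splits)
  moreover have "x1 = (x1 - 1) + p x1" "x5 = (x5 - 1) + p x5"
    by (rule p)+
  ultimately have "3 * k + 2 + (x1 - 1) + (x5 - 1) + m
      \<le> x1 + x2 + x3 + x4 + x5 + x6 + x7 + x8 + x9 + x10"
    if "m = 0 \<or> m = 1 \<and> u \<le> k \<and> v \<le> k" for m
    using that by linarith
  then show ?thesis by simp
qed

section \<open>Neighbourhoods and label sums in the gadget graph\<close>

locale oriented_graph =
  fixes G :: "'a ugraph" and src tgt :: "'a set \<Rightarrow> 'a"
  assumes simple: "simple_graph G" and orientation: "edge_orientation G src tgt"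
begin

abbreviation F :: "'a gvertex ugraph" where
  "F \<equiv> gadget_graph G src tgt"

lemma finite_verts: "finite (verts G)"
  using simple by (simp add: simple_graph_def)

lemma finite_edges: "finite (edges G)"
  by (rule finite_subset [of _ "Pow (verts G)"])
    (use simple in \<open>auto simp: simple_graph_def\<close>)

lemma edge_eq: "e \<in> edges G \<Longrightarrow> e = {src e, tgt e}"
  using orientation by (simp add: edge_orientation_def)

lemma src_in_verts: "e \<in> edges G \<Longrightarrow> src e \<in> verts G"
  and tgt_in_verts: "e \<in> edges G \<Longrightarrow> tgt e \<in> verts G"
  using edge_eq simple by (auto simp: simple_graph_def)

lemma verts_gadget_graph: "verts F = Old ` verts G \<union> (\<Union>e\<in>edges G. New e ` {1..10})"
  and edges_gadget_graph: "edges F = (\<Union>e\<in>edges G. gadget_edges e (src e) (tgt e))"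
  by (simp_all add: gadget_graph_def)

lemma Old_in_verts_iff [simp]: "Old v \<in> verts F \<longleftrightarrow> v \<in> verts G"
  and New_in_verts_iff [simp]: "New e i \<in> verts F \<longleftrightarrow> e \<in> edges G \<and> 1 \<le> i \<and> i \<le> 10"
  by (auto simp: verts_gadget_graph image_iff)

lemma finite_verts_gadget_graph: "finite (verts F)"
  by (simp add: verts_gadget_graph finite_verts finite_edges)

lemma loopless_gadget_graph: "{x} \<notin> edges F"
  by (auto simp: edges_gadget_graph gadget_edges_def)

lemma neighborhood_New:
  assumes "e \<in> edges G"
  shows "neighborhood F (New e 1) = {Old (src e), New e 2}"
    "neighborhood F (New e 2) = {New e 1, New e 3, New e 7}"
    "neighborhood F (New e 3) = {New e 2, New e 4}"
    "neighborhood F (New e 4) = {New e 3, New e 5, New e 9}"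
    "neighborhood F (New e 5) = {Old (tgt e), New e 4}"
    "neighborhood F (New e 6) = {New e 7}"
    "neighborhood F (New e 7) = {New e 6, New e 8, New e 2}"
    "neighborhood F (New e 8) = {New e 7, New e 9}"
    "neighborhood F (New e 9) = {New e 8, New e 10, New e 4}"
    "neighborhood F (New e 10) = {New e 9}"
  using assms src_in_verts [OF assms] tgt_in_verts [OF assms]
  by (auto simp: neighborhood_def edges_gadget_graph gadget_edges_def
      doubleton_eq_iff)

lemma neighborhood_Old:
  "neighborhood F (Old v) =
    (\<lambda>e. New e 1) ` {e \<in> edges G. src e = v} \<union> (\<lambda>e. New e 5) ` {e \<in> edges G. tgt e = v}"
  by (auto simp: neighborhood_def edges_gadget_graph gadget_edges_def
      doubleton_eq_iff)

text \<open>Padding with zeros makes the index set independent of \<open>v\<close>, so that the sum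
  can later be interchanged with one over the vertices.\<close>

lemma sum_neighborhood_Old:
  fixes g :: "'a gvertex \<Rightarrow> nat"
  shows "sum g (neighborhood F (Old v)) =
    (\<Sum>e\<in>edges G. (if src e = v then g (New e 1) else 0) + (if tgt e = v then g (New e 5) else 0))"
proof -
  have "sum g (neighborhood F (Old v)) =
      sum g ((\<lambda>e. New e 1) ` {e \<in> edges G. src e = v}) +
      sum g ((\<lambda>e. New e 5) ` {e \<in> edges G. tgt e = v})"
    unfolding neighborhood_Old using finite_edges by (intro sum.union_disjoint) auto
  also have "\<dots> = (\<Sum>e | e \<in> edges G \<and> src e = v. g (New e 1)) +
      (\<Sum>e | e \<in> edges G \<and> tgt e = v. g (New e 5))"
    by (simp add: sum.reindex inj_on_def)
  also have "\<dots> = (\<Sum>e\<in>edges G. if src e = v then g (New e 1) else 0) +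
      (\<Sum>e\<in>edges G. if tgt e = v then g (New e 5) else 0)"
    using finite_edges by (simp add: sum.If_cases Int_def)
  finally show ?thesis
    by (simp add: sum.distrib)
qed

lemma sum_verts_gadget_graph:
  fixes f :: "'a gvertex \<Rightarrow> nat"
  shows "sum f (verts F) = (\<Sum>v\<in>verts G. f (Old v)) + (\<Sum>e\<in>edges G. \<Sum>i=1..10. f (New e i))"
proof -
  have "sum f (verts F) = sum f (Old ` verts G) + sum f (\<Union>e\<in>edges G. New e ` {1..10})"
    unfolding verts_gadget_graph using finite_verts finite_edges
    by (intro sum.union_disjoint) auto
  also have "sum f (\<Union>e\<in>edges G. New e ` {1..10}) = (\<Sum>e\<in>edges G. sum f (New e ` {1..10}))"
    using finite_edges by (intro sum.UNION_disjoint) auto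
  finally show ?thesis
    by (simp add: sum.reindex inj_on_def)
qed

lemma sum_upto_10: "(\<Sum>i=1..10. g i) =
    g 1 + g 2 + g 3 + g 4 + g 5 + g 6 + g 7 + g 8 + g 9 + g 10" for g :: "nat \<Rightarrow> nat"
  by (simp add: numeral_eq_Suc add.assoc)

section \<open>Lower bound by discharging from gadgets to old vertices\<close>

lemma k_RDF_weight_ge:
  assumes "k \<ge> 3" and f: "k_RDF k F f"
  obtains C where "vertex_cover G C"
    and "card C + k * card (verts G) + (3 * k + 2) * card (edges G) \<le> sum f (verts F)"
proof -
  have le: "f x \<le> k + 1" and dom: "k \<le> f x + (\<Sum>w\<in>neighborhood F x. f w - 1)"
    if "x \<in> verts F" for x
    using f that k_RDF_iff_sum_pred [OF finite_verts_gadget_graph loopless_gadget_graph] by blast+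
  have Old_in: "Old v \<in> verts F" if "v \<in> verts G" for v
    using that by simp
  define low where "low e \<longleftrightarrow> f (Old (src e)) \<le> k \<and> f (Old (tgt e)) \<le> k" for e
  define C where "C = {v \<in> verts G. f (Old v) = k + 1} \<union> src ` {e \<in> edges G. low e}"
  \<comment> \<open>What gadget \<open>e\<close> passes to \<open>v\<close>: the excess of the
    attached new vertex and, if \<open>e\<close> is \<open>low\<close>, the additional unit, which
    always goes to the source.\<close>
  define share where "share e v =
      (if src e = v then f (New e 1) - 1 else 0) + (if tgt e = v then f (New e 5) - 1 else 0) +
      (if src e = v then of_bool (low e) else 0)" for e v
  have C: "C \<subseteq> verts G"
    using src_in_verts by (auto simp: C_def)
  have cover: "vertex_cover G C"
    unfolding vertex_cover_def
  proof (intro conjI ballI)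
    fix e assume e: "e \<in> edges G"
    then have "f (Old (src e)) \<le> k + 1" "f (Old (tgt e)) \<le> k + 1"
      using le Old_in src_in_verts tgt_in_verts by blast+
    then have "src e \<in> C \<or> tgt e \<in> C"
      using e src_in_verts [OF e] tgt_in_verts [OF e] by (auto simp: C_def low_def)
    then show "e \<inter> C \<noteq> {}"
      using edge_eq [OF e] by blast
  qed (rule C)
  have vertex: "k + of_bool (v \<in> C) \<le> f (Old v) + (\<Sum>e\<in>edges G. share e v)"
    if v: "v \<in> verts G" for v
  proof -
    let ?b = "\<Sum>e\<in>edges G. if src e = v then of_bool (low e) else 0 :: nat"
    have "(\<Sum>e\<in>edges G. share e v) = (\<Sum>w\<in>neighborhood F (Old v). f w - 1) + ?b"
      unfolding sum_neighborhood_Old share_def by (rule sum.distrib)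
    then have *: "f (Old v) + (\<Sum>e\<in>edges G. share e v) \<ge> k + ?b"
      using dom [OF Old_in [OF v]] by simp
    \<comment> \<open>Outside \<open>C\<close> domination alone suffices, and so does a label
      \<open>k + 1\<close>; a \<open>low\<close> gadget with source \<open>v\<close> adds its unit
      to the \<open>k\<close> given by domination.\<close>
    consider "v \<notin> C" | "f (Old v) = k + 1" | e where "e \<in> edges G" "low e" "src e = v"
      by (auto simp: C_def)
    then show ?thesis
    proof cases
      case 3
      then have "(1::nat) = (if src e = v then of_bool (low e) else 0)"
        by simp
      also have "\<dots> \<le> ?b"
        using 3 finite_edges by (intro member_le_sum) auto
      finally show ?thesis
        using * by (simp add: of_bool_def)
    qed (use * in auto)
  qed
  have gadget: "3 * k + 2 + (\<Sum>v\<in>verts G. share e v) \<le> (\<Sum>i=1..10. f (New e i))"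
    if e: "e \<in> edges G" for e
  proof -
    have "(\<Sum>v\<in>verts G. share e v) = (f (New e 1) - 1) + (f (New e 5) - 1) + of_bool (low e)"
      using finite_verts src_in_verts [OF e] tgt_in_verts [OF e]
      by (simp add: share_def sum.distrib)
    moreover
    have c1: "k \<le> f (New e 1) + (f (Old (src e)) - 1) + (f (New e 2) - 1)"
      using dom [of "New e 1"] e unfolding neighborhood_New [OF e] by simp
    have c2: "k \<le> f (New e 2) + (f (New e 1) - 1) + (f (New e 3) - 1) + (f (New e 7) - 1)"
      using dom [of "New e 2"] e unfolding neighborhood_New [OF e] by simp
    have c3: "k \<le> f (New e 3) + (f (New e 2) - 1) + (f (New e 4) - 1)"
      using dom [of "New e 3"] e unfolding neighborhood_New [OF e] by simp
    have c4: "k \<le> f (New e 4) + (f (New e 3) - 1) + (f (New e 5) - 1) + (f (New e 9) - 1)"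
      using dom [of "New e 4"] e unfolding neighborhood_New [OF e] by simp
    have c5: "k \<le> f (New e 5) + (f (Old (tgt e)) - 1) + (f (New e 4) - 1)"
      using dom [of "New e 5"] e unfolding neighborhood_New [OF e] by simp
    have c6: "k \<le> f (New e 6) + (f (New e 7) - 1)"
      using dom [of "New e 6"] e unfolding neighborhood_New [OF e] by simp
    have c8: "k \<le> f (New e 8) + (f (New e 7) - 1) + (f (New e 9) - 1)"
      using dom [of "New e 8"] e unfolding neighborhood_New [OF e] by simp
    have c10: "k \<le> f (New e 10) + (f (New e 9) - 1)"
      using dom [of "New e 10"] e unfolding neighborhood_New [OF e] by simp
    note gadget_weight_ge [OF \<open>k \<ge> 3\<close> le [OF Old_in [OF src_in_verts [OF e]]]
        le [OF Old_in [OF tgt_in_verts [OF e]]] c1 c2 c3 c4 c5 c6 c8 c10]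
    ultimately show ?thesis
      unfolding sum_upto_10 by (simp add: low_def of_bool_def)
  qed
  have "card C = (\<Sum>v\<in>verts G. of_bool (v \<in> C))"
    using C finite_verts by (simp add: Int_absorb1)
  then have "card C + k * card (verts G) + (3 * k + 2) * card (edges G) =
      (\<Sum>v\<in>verts G. k + of_bool (v \<in> C)) + (\<Sum>e\<in>edges G. 3 * k + 2)"
    unfolding sum.distrib by simp
  also have "\<dots> \<le> (\<Sum>v\<in>verts G. f (Old v) + (\<Sum>e\<in>edges G. share e v)) + (\<Sum>e\<in>edges G. 3 * k + 2)"
    using vertex by (intro add_right_mono sum_mono)
  \<comment> \<open>Double counting: what the vertices receive is charged to the gadgets, each of
    which can afford it by \<open>gadget\<close>.\<close>
  also have "\<dots> = (\<Sum>v\<in>verts G. f (Old v)) + (\<Sum>e\<in>edges G. 3 * k + 2 + (\<Sum>v\<in>verts G. share e v))"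
    unfolding sum.distrib using sum.swap [of "\<lambda>v e. share e v" "edges G" "verts G"] by simp
  also have "\<dots> \<le> sum f (verts F)"
    unfolding sum_verts_gadget_graph using gadget by (intro add_left_mono sum_mono)
  finally show ?thesis
    using that cover by blast
qed

section \<open>Upper bound from a vertex cover\<close>

lemma independent_k_RDF_of_cover:
  assumes "k \<ge> 1" and C: "vertex_cover G C"
  obtains f where "independent_k_RDF k F f"
    and "sum f (verts F) = card C + k * card (verts G) + (3 * k + 2) * card (edges G)"
proof -
  \<comment> \<open>The covered end dominates the new vertex next to it, and the three labelled
    vertices take care of the other nine. The two patterns are mirror images under the symmetry of
    the gadget that exchanges its ends.\<close>
  define f where "f x = (case x of
      Old v \<Rightarrow> k + of_bool (v \<in> C)
    | New e i \<Rightarrow>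
        if src e \<in> C
        then (if i = 4 \<or> i = 7 then k + 1 else if i = 10 then k else 0)
        else (if i = 2 \<or> i = 9 then k + 1 else if i = 6 then k else 0))" for x
  have cover: "src e \<in> C \<or> tgt e \<in> C" if "e \<in> edges G" for e
  proof -
    have "e \<inter> C \<noteq> {}"
      using C that by (simp add: vertex_cover_def)
    moreover have "e \<subseteq> {src e, tgt e}"
      using edge_eq [OF that] by simp
    ultimately show ?thesis by blast
  qed
  \<comment> \<open>A single neighbour of label \<open>k + 1\<close> contributes the whole
    \<open>k\<close>.\<close>
  have dominated: "k \<le> f (New e i) \<or> (\<exists>w\<in>neighborhood F (New e i). f w = k + 1)"
    if e: "e \<in> edges G" and i: "i \<in> {1..10}" for e i
  proof -
    have "i = 1 \<or> i = 2 \<or> i = 3 \<or> i = 4 \<or> i = 5 \<or> i = 6 \<or> i = 7 \<or> i = 8 \<or> i = 9 \<or> i = 10"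
      using i unfolding atLeastAtMost_iff by presburger
    then show ?thesis
      using cover [OF e]
      by (elim disjE; hypsubst; simp only: neighborhood_New [OF e]; simp add: f_def)
  qed
  have "k_RDF k F f"
    unfolding k_RDF_iff_sum_pred [OF finite_verts_gadget_graph loopless_gadget_graph]
  proof (intro ballI conjI)
    fix x assume x: "x \<in> verts F"
    show "f x \<le> k + 1"
      by (auto simp: f_def split: gvertex.split)
    have "k \<le> f x \<or> (\<exists>w\<in>neighborhood F x. f w = k + 1)"
      using x dominated by (cases x) (auto simp: f_def)
    then show "k \<le> f x + (\<Sum>w\<in>neighborhood F x. f w - 1)"
    proof
      assume "\<exists>w\<in>neighborhood F x. f w = k + 1"
      then obtain w where w: "w \<in> neighborhood F x" "f w = k + 1" by blast
      have "finite (neighborhood F x)"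
        using finite_verts_gadget_graph by (simp add: neighborhood_def)
      then have "f w - 1 \<le> (\<Sum>w\<in>neighborhood F x. f w - 1)"
        using w by (intro member_le_sum) auto
      then show ?thesis using w by simp
    qed simp
  qed
  \<comment> \<open>Old vertices are adjacent only to vertices \<open>New e 1\<close> and
    \<open>New e 5\<close>, which have label 0 in both patterns.\<close>
  moreover have "f x = 0 \<or> f y = 0" if xy: "{x, y} \<in> edges F" for x y
  proof -
    obtain e where "{x, y} \<in> gadget_edges e (src e) (tgt e)"
      using xy by (auto simp: edges_gadget_graph)
    then show ?thesis
      unfolding gadget_edges_def insert_iff doubleton_eq_iff empty_iff
      by (elim disjE conjE FalseE; hypsubst; simp add: f_def)
  qed
  then have "independent_set F {x \<in> verts F. f x \<ge> 1}"
    unfolding independent_set_def by fastforce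
  moreover have "sum f (verts F) = card C + k * card (verts G) + (3 * k + 2) * card (edges G)"
  proof -
    have "(\<Sum>i=1..10. f (New e i)) = 3 * k + 2" for e
      unfolding sum_upto_10 by (simp add: f_def)
    moreover have "(\<Sum>v\<in>verts G. f (Old v)) = k * card (verts G) + card C"
      using C finite_verts
      by (simp add: f_def sum.distrib vertex_cover_def Int_absorb1)
    ultimately show ?thesis
      unfolding sum_verts_gadget_graph by simp
  qed
  ultimately show ?thesis
    using that by (simp add: independent_k_RDF_def)
qed

section \<open>Both domination numbers\<close>

lemma minimum_cover:
  obtains C where "vertex_cover G C" and "card C = cover_number G"
proof -
  have "vertex_cover G (verts G)"
    using edge_eq src_in_verts by (fastforce simp: vertex_cover_def)
  then have "\<exists>C. vertex_cover G C \<and> card C = cover_number G"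
    using LeastI_ex [of "\<lambda>n. \<exists>C. vertex_cover G C \<and> card C = n"]
    unfolding cover_number_def by blast
  then show ?thesis using that by blast
qed

text \<open>The lower bound covers all labellings and the witness attaining it is independent, so
  both minima take the same value.\<close>

lemma roman_domination_numbers:
  fixes k defines "m \<equiv> cover_number G + k * card (verts G) + (3 * k + 2) * card (edges G)"
  assumes "k \<ge> 3"
  shows "k_roman_domination_number k F = m"
    and "independent_k_roman_domination_number k F = m"
proof -
  obtain C where C: "vertex_cover G C" "card C = cover_number G"
    by (rule minimum_cover)
  have "k \<ge> 1"
    using \<open>k \<ge> 3\<close> by simp
  then obtain f where f: "independent_k_RDF k F f" "sum f (verts F) = m"
    using C(1) by (rule independent_k_RDF_of_cover) (simp add: C(2) m_def)
  have lower: "m \<le> sum g (verts F)" if "k_RDF k F g" for g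
  proof -
    obtain C where "vertex_cover G C"
      and C: "card C + k * card (verts G) + (3 * k + 2) * card (edges G) \<le> sum g (verts F)"
      using k_RDF_weight_ge [OF \<open>k \<ge> 3\<close> \<open>k_RDF k F g\<close>] .
    then have "cover_number G \<le> card C"
      unfolding cover_number_def by (intro Least_le) blast
    then show ?thesis
      using C unfolding m_def by linarith
  qed
  show "k_roman_domination_number k F = m"
    unfolding k_roman_domination_number_def
    using f lower by (intro Least_equality) (auto simp: independent_k_RDF_def)
  show "independent_k_roman_domination_number k F = m"
    unfolding independent_k_roman_domination_number_def
    using f lower by (intro Least_equality) (auto simp: independent_k_RDF_def)
qed

end

theorem theorem2p6:
  fixes k :: nat and G :: "'a ugraph" and src tgt :: "'a set \<Rightarrow> 'a"
    and F :: "'a gvertex ugraph"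
  assumes "k \<ge> 3"
    and "simple_graph G"
    and "vertex_connected 2 G"
    and "planar G"
    and "regular 3 G"
    and "edge_orientation G src tgt"
    and "F = gadget_graph G src tgt"
  shows "k_roman_domination_number k F = independent_k_roman_domination_number k F
    \<and> independent_k_roman_domination_number k F
        = cover_number G + k * card (verts G) + (3 * k + 2) * card (edges G)"
proof -
  interpret oriented_graph G src tgt
    using assms by unfold_locales
  show ?thesis
    using roman_domination_numbers [OF \<open>k \<ge> 3\<close>] \<open>F = gadget_graph G src tgt\<close> by simp
qed

end
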